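(* Let $R$ be a noetherian ring. If $i(R)<\infty$, then the Krull dimension of $R$ is finite, i.e. $\dim(R)<\infty$.
   Context: All rings are commutative with identity. For an ideal $J$ of a noetherian ring $R$, an element $x\in R$ is integral over $J$ if $x^n+a_1x^{n-1}+\cdots+a_n=0$ for some $n\geq 1$ and $a_i\in J^i$ ($1\le i\le n$); the integral closure $\overline{J}$ is the ideal of all elements integral over $J$. The integral dimension $i(R)$ of a noetherian ring $R$ is the least integer $k\geq 0$ such that $(\overline{J})^n\subseteq J^{n-k}$ for all ideals $J$ of $R$ and all $n\geq k$ (with $J^0=R$), if such a $k$ exists; otherwise $i(R)=\infty$. *)

theory Defs
  imports
    "HOL-Algebra.Ring_Divisibility"
    "HOL-Algebra.Ideal_Product"
    "HOL-Library.Extended_Nat"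
begin

(* The power J^n in the library's monoid of ideals; in particular J^0 = R. *)
definition ideal_power :: "('a, 'b) ring_scheme \<Rightarrow> 'a set \<Rightarrow> nat \<Rightarrow> 'a set"
  where "ideal_power R J n = J [^]\<^bsub>ideals_set R\<^esub> n"

lemma ideal_power_0: "ideal_power R J 0 = carrier R"
  by (simp add: ideal_power_def nat_pow_def ideals_set_def)

lemma ideal_power_Suc: "ideal_power R J (Suc n) = ideal_power R J n \<cdot>\<^bsub>R\<^esub> J"
  by (simp add: ideal_power_def nat_pow_def ideals_set_def)

definition integral_over_ideal :: "('a, 'b) ring_scheme \<Rightarrow> 'a set \<Rightarrow> 'a \<Rightarrow> bool"
  where "integral_over_ideal R J x \<longleftrightarrow>
    x \<in> carrier R \<and>
    (\<exists>n\<ge>1. \<exists>a :: nat \<Rightarrow> 'a. (\<forall>i\<in>{1..n}. a i \<in> ideal_power R J i) \<and>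
       x [^]\<^bsub>R\<^esub> n \<oplus>\<^bsub>R\<^esub> (\<Oplus>\<^bsub>R\<^esub>i\<in>{1..n}. a i \<otimes>\<^bsub>R\<^esub> x [^]\<^bsub>R\<^esub> (n - i)) = \<zero>\<^bsub>R\<^esub>)"

definition ideal_integral_closure :: "('a, 'b) ring_scheme \<Rightarrow> 'a set \<Rightarrow> 'a set"
  where "ideal_integral_closure R J = {x. integral_over_ideal R J x}"

definition integral_dim_bound :: "('a, 'b) ring_scheme \<Rightarrow> nat \<Rightarrow> bool"
  where "integral_dim_bound R k \<longleftrightarrow>
    (\<forall>J n. ideal J R \<longrightarrow> k \<le> n \<longrightarrow>
       ideal_power R (ideal_integral_closure R J) n \<subseteq> ideal_power R J (n - k))"

definition integral_dim :: "('a, 'b) ring_scheme \<Rightarrow> enat"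
  where "integral_dim R =
    (if \<exists>k. integral_dim_bound R k then enat (LEAST k. integral_dim_bound R k) else \<infinity>)"

(* Supremum of the lengths n of chains P 0 < ... < P n of prime ideals. In enat the
   supremum of the empty set is 0, so the zero ring gets dimension 0 here. *)
definition krull_dim :: "('a, 'b) ring_scheme \<Rightarrow> enat"
  where "krull_dim R =
    Sup {enat n | n. \<exists>P :: nat \<Rightarrow> 'a set.
      (\<forall>i\<le>n. primeideal (P i) R) \<and> (\<forall>i<n. P i \<subset> P (Suc i))}"

end

theory Submission
  imports Defs
begin

text \<open>
  If \<open>k\<close> is an admissible bound in the definition of the integral dimension, then \<open>R\<close> has no
  strictly increasing chain of primes of length \<open>2k + 2\<close>, so \<open>dim R \<le> 2k + 1\<close>.

  Suppose \<open>P\<^sub>0 \<subset> \<dots> \<subset> P\<^sub>r\<close> is such a chain, with \<open>r = 2k + 2\<close>, and pick \<open>x\<^sub>i \<in> P\<^sub>i\<^sub>+\<^sub>1 - P\<^sub>i\<close>. For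
  exponents \<open>M\<^sub>i\<close> put \<open>z\<^sub>i = x\<^sub>i^M\<^sub>i\<close> and let \<open>J\<close> be generated by the squares \<open>z\<^sub>i\<^sup>2\<close>. A product
  \<open>z\<^sub>i z\<^sub>j\<close> is integral over \<open>J\<close>, because its square \<open>z\<^sub>i\<^sup>2 z\<^sub>j\<^sup>2\<close> lies in \<open>J\<^sup>2\<close>. Grouping the
  factors in pairs shows that \<open>z\<^sub>0 \<dots> z\<^sub>r\<^sub>-\<^sub>1\<close> lies in the power \<open>k + 1\<close> of the integral
  closure (\<open>even_product_in_power_of_closure\<close>), hence in \<open>J\<close>, whatever the exponents are.

  On the other hand, some choice of exponents makes this impossible
  (\<open>product_notin_ideal_of_squares\<close>). Assume that for all exponents the product lies in \<open>J\<close>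
  after localizing at \<open>P\<^sub>r\<close>. Fix all exponents but the last and let that one, \<open>n\<close>, grow: with
  \<open>y\<close> the product of the other factors, \<open>I\<close> the ideal of their squares and \<open>x\<close> the last
  element, \<open>y x^n\<close> lies in \<open>I + (x^(2n))\<close> for every \<open>n\<close>. Thus \<open>y\<close> lies in \<open>Q + (x^n)\<close>, where
  \<open>Q\<close> is the saturation of \<open>I\<close> by \<open>x\<close>. As \<open>Q\<close> does not depend on \<open>n\<close>, Krull's
  intersection theorem at \<open>P\<^sub>r\<close> puts \<open>y\<close> in \<open>Q\<close>. Since \<open>x\<close> is a unit at \<open>P\<^sub>r\<^sub>-\<^sub>1\<close>, the
  element \<open>y\<close> lies in \<open>I\<close> after localizing at \<open>P\<^sub>r\<^sub>-\<^sub>1\<close>: this is the same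
  assumption for a chain that is shorter by one. At the bottom of the chain it says that \<open>1\<close> is
  zero in the localization at \<open>P\<^sub>0\<close>, which is absurd.

  That \<open>y\<close> lies in \<open>I\<close> after localizing at \<open>P\<close> is expressed by a multiplier \<open>u \<notin> P\<close> with
  \<open>u y \<in> I\<close>, so that all computations stay in \<open>R\<close>.
\<close>

section \<open>Ideals in a commutative ring\<close>

context cring
begin

lemma saturation_is_ideal:
  assumes "ideal I R" and x: "x \<in> carrier R"
  shows "ideal {r \<in> carrier R. \<exists>n::nat. x [^] n \<otimes> r \<in> I} R" (is "ideal ?Q R")
proof -
  interpret I: ideal I R by fact
  have mult: "r \<otimes> c \<in> ?Q" "c \<otimes> r \<in> ?Q" if r: "r \<in> ?Q" and c: "c \<in> carrier R" for r c
  proof -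
    obtain n :: nat where n: "x [^] n \<otimes> r \<in> I" using r by blast
    have "x [^] n \<otimes> (r \<otimes> c) \<in> I"
      using I.I_r_closed[OF n c] r c x by (simp add: m_assoc)
    then show "r \<otimes> c \<in> ?Q" using r c by blast
    then show "c \<otimes> r \<in> ?Q" using r c by (simp add: m_comm)
  qed
  show ?thesis
  proof (rule idealI[OF ring_axioms])
    show "subgroup ?Q (add_monoid R)"
    proof (rule group.subgroupI[OF a_group])
      have "x [^] (0::nat) \<otimes> \<zero> \<in> I" by simp
      then show "?Q \<noteq> {}" by blast
    next
      fix r assume r: "r \<in> ?Q"
      have "\<ominus> r = (\<ominus> \<one>) \<otimes> r" using r by (simp add: l_minus)
      then show "inv\<^bsub>add_monoid R\<^esub> r \<in> ?Q"
        using mult(2)[OF r, of "\<ominus> \<one>"] by (simp add: a_inv_def)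
    next
      fix r s assume r: "r \<in> ?Q" and s: "s \<in> ?Q"
      obtain m n :: nat where m: "x [^] m \<otimes> r \<in> I" and n: "x [^] n \<otimes> s \<in> I"
        using r s by blast
      have "x [^] (m + n) \<otimes> (r \<oplus> s)
          = x [^] n \<otimes> (x [^] m \<otimes> r) \<oplus> x [^] m \<otimes> (x [^] n \<otimes> s)"
        using r s x by (simp add: nat_pow_mult[symmetric] r_distr m_ac)
      also have "\<dots> \<in> I" using m n x by (simp add: I.I_l_closed)
      finally show "r \<otimes>\<^bsub>add_monoid R\<^esub> s \<in> ?Q" using r s by auto
    qed auto
  qed (use mult in auto)
qed

lemma colon_is_ideal:
  assumes "ideal I R" and a: "a \<in> carrier R"
  shows "ideal {r \<in> carrier R. a \<otimes> r \<in> I} R"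
proof -
  interpret I: ideal I R by fact
  show ?thesis
  proof (rule idealI[OF ring_axioms])
    show "subgroup {r \<in> carrier R. a \<otimes> r \<in> I} (add_monoid R)"
    proof (rule group.subgroupI[OF a_group])
      have "a \<otimes> \<zero> \<in> I" using a by simp
      then show "{r \<in> carrier R. a \<otimes> r \<in> I} \<noteq> {}" by blast
    qed (use a in \<open>auto simp: a_inv_def[symmetric] r_minus r_distr\<close>)
  next
    fix r c assume r: "r \<in> {r \<in> carrier R. a \<otimes> r \<in> I}" and c: "c \<in> carrier R"
    have "a \<otimes> (r \<otimes> c) \<in> I" using I.I_r_closed[of "a \<otimes> r" c] r c a by (simp add: m_assoc)
    then show "r \<otimes> c \<in> {r \<in> carrier R. a \<otimes> r \<in> I}" "c \<otimes> r \<in> {r \<in> carrier R. a \<otimes> r \<in> I}"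
      using r c by (auto simp: m_comm)
  qed
qed

lemma mem_add_PIdl:
  assumes "y \<in> I <+>\<^bsub>R\<^esub> PIdl a"
  obtains i c where "i \<in> I" "c \<in> carrier R" "y = i \<oplus> c \<otimes> a"
  using assms by (auto simp: set_add_def' cgenideal_def)

lemma add_PIdlI:
  assumes "i \<in> I" "c \<in> carrier R"
  shows "i \<oplus> c \<otimes> a \<in> I <+>\<^bsub>R\<^esub> PIdl a"
  using assms by (auto simp: set_add_def' cgenideal_def)

lemma genideal_insert_subset:
  assumes S: "S \<subseteq> carrier R" and a: "a \<in> carrier R"
  shows "Idl (insert a S) \<subseteq> Idl S <+>\<^bsub>R\<^esub> PIdl a"
proof (rule genideal_minimal)
  have idl: "ideal (Idl S) R" using S by (rule genideal_ideal)
  show "ideal (Idl S <+>\<^bsub>R\<^esub> PIdl a) R"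
    by (rule add_ideals[OF idl cgenideal_ideal[OF a]])
  interpret J: ideal "Idl S" R by (rule idl)
  have "\<zero> \<oplus> \<one> \<otimes> a \<in> Idl S <+>\<^bsub>R\<^esub> PIdl a" by (rule add_PIdlI) auto
  moreover have "s \<oplus> \<zero> \<otimes> a \<in> Idl S <+>\<^bsub>R\<^esub> PIdl a" if "s \<in> S" for s
    using genideal_self[OF S] that by (intro add_PIdlI) auto
  ultimately show "insert a S \<subseteq> Idl S <+>\<^bsub>R\<^esub> PIdl a"
    using S a by (auto simp: subset_iff)
qed

end

section \<open>Lowering the prime by one step\<close>

lemma (in noetherian_ring) ascending_ideals_stabilize:
  fixes A :: "nat \<Rightarrow> 'a set"
  assumes idl: "\<And>n. ideal (A n) R" and inc: "\<And>n. A n \<subseteq> A (Suc n)"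
  obtains n where "A (Suc n) = A n"
proof -
  have mono: "A m \<subseteq> A n" if "m \<le> n" for m n
    using inc that by (rule lift_Suc_mono_le)
  have "subset.chain {I. ideal I R} (range A)"
  proof -
    have "A m \<subset> A n \<or> A m = A n \<or> A n \<subset> A m" for m n
      using mono[of m n] mono[of n m] by (cases "m \<le> n") auto
    then show ?thesis unfolding pred_on.chain_def using idl by auto
  qed
  then have "\<Union>(range A) \<in> range A"
    by (intro ideal_chain_is_trivial) auto
  then obtain n where "\<Union>(range A) = A n" by blast
  then have "A (Suc n) = A n" using inc[of n] by blast
  then show thesis by (rule that)
qed

text \<open>
  Krull's intersection theorem for the image of \<open>y\<close> in the localization of \<open>R / Q\<close> at \<open>P\<close>. The
  ideals \<open>(K : x^m)\<close> with \<open>K = Q + (x y)\<close> increase, so \<open>(K : x^n) = (K : x^(n+1))\<close> for some \<open>n\<close>.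
  If \<open>u y \<equiv> b x^n\<close> modulo \<open>Q\<close>, then \<open>b x^(n+1)\<close> lies in \<open>K\<close>, hence so does \<open>b x^n\<close>, and therefore
  \<open>u y \<equiv> c x y\<close> modulo \<open>Q\<close> for some \<open>c\<close>. The new multiplier \<open>u - c x\<close> avoids \<open>P\<close> because \<open>x\<close>
  lies in \<open>P\<close>.
\<close>

lemma (in cring) krull_intersection_at_prime:
  assumes noeth: "noetherian_ring R" and "ideal Q R" and "primeideal P R"
    and x: "x \<in> P" and y: "y \<in> carrier R"
    and approx: "\<And>n::nat. \<exists>u \<in> carrier R - P. u \<otimes> y \<in> Q <+>\<^bsub>R\<^esub> PIdl (x [^] n)"
  shows "\<exists>u \<in> carrier R - P. u \<otimes> y \<in> Q"
proof -
  interpret N: noetherian_ring R by fact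
  interpret Q: ideal Q R by fact
  interpret P: primeideal P R by fact
  have xR: "x \<in> carrier R" using x by (rule P.Icarr)
  define K where "K = Q <+>\<^bsub>R\<^esub> PIdl (x \<otimes> y)"
  have K: "ideal K R" unfolding K_def
    using xR y by (intro add_ideals cgenideal_ideal) (auto intro: Q.ideal_axioms)
  interpret K: ideal K R by (rule K)
  have QK: "q \<in> K" if "q \<in> Q" for q
  proof -
    have "q \<oplus> \<zero> \<otimes> (x \<otimes> y) \<in> K" unfolding K_def using that by (rule add_PIdlI) simp
    then show ?thesis using that xR y by simp
  qed
  have xyK: "c \<otimes> (x \<otimes> y) \<in> K" if "c \<in> carrier R" for c
  proof -
    have "\<zero> \<oplus> c \<otimes> (x \<otimes> y) \<in> K" unfolding K_def using that by (intro add_PIdlI) auto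
    then show ?thesis using that xR y by simp
  qed
  obtain n where n: "{r \<in> carrier R. x [^] Suc n \<otimes> r \<in> K} = {r \<in> carrier R. x [^] n \<otimes> r \<in> K}"
  proof (rule N.ascending_ideals_stabilize)
    show "ideal {r \<in> carrier R. x [^] m \<otimes> r \<in> K} R" for m :: nat
      using K xR by (intro colon_is_ideal) auto
    show "{r \<in> carrier R. x [^] m \<otimes> r \<in> K} \<subseteq> {r \<in> carrier R. x [^] Suc m \<otimes> r \<in> K}" for m :: nat
    proof clarsimp
      fix r assume r: "r \<in> carrier R" and "x [^] m \<otimes> r \<in> K"
      then have "x \<otimes> (x [^] m \<otimes> r) \<in> K" using xR by (simp add: K.I_l_closed)
      then show "x [^] m \<otimes> x \<otimes> r \<in> K" using r xR by (simp add: m_ac)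
    qed
  qed
  obtain u where u: "u \<in> carrier R" "u \<notin> P" and "u \<otimes> y \<in> Q <+>\<^bsub>R\<^esub> PIdl (x [^] n)"
    using approx[of n] by blast
  then obtain q b where q: "q \<in> Q" and b: "b \<in> carrier R" and uy: "u \<otimes> y = q \<oplus> b \<otimes> x [^] n"
    by (elim mem_add_PIdl)
  have qR: "q \<in> carrier R" using q by (rule Q.Icarr)
  have powR: "x [^] n \<in> carrier R" using xR by simp
  have "x [^] Suc n \<otimes> b = x \<otimes> (q \<oplus> b \<otimes> x [^] n) \<ominus> x \<otimes> q"
    unfolding nat_pow_Suc using powR xR b qR by algebra
  also have "\<dots> = x \<otimes> (u \<otimes> y) \<ominus> x \<otimes> q" by (simp only: uy)
  also have "\<dots> = u \<otimes> (x \<otimes> y) \<ominus> x \<otimes> q" using m_lcomm[OF xR u(1) y] by simp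
  also have "\<dots> \<in> K"
    unfolding minus_eq using u xR q xyK QK by (simp add: Q.I_l_closed K.a_closed)
  finally have "x [^] n \<otimes> b \<in> K" using n b by blast
  then have "b \<otimes> x [^] n \<in> K" using b xR by (simp add: m_comm)
  then have "u \<otimes> y \<in> K" using uy QK[OF q] by (simp add: K.a_closed)
  then obtain q' c where q': "q' \<in> Q" and c: "c \<in> carrier R" and uy': "u \<otimes> y = q' \<oplus> c \<otimes> (x \<otimes> y)"
    unfolding K_def by (elim mem_add_PIdl)
  have q'R: "q' \<in> carrier R" using q' by (rule Q.Icarr)
  have "(u \<ominus> c \<otimes> x) \<otimes> y = u \<otimes> y \<ominus> c \<otimes> (x \<otimes> y)"
    using u c xR y by algebra
  also have "\<dots> = q'" unfolding uy' using q'R c xR y by algebra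
  finally have "(u \<ominus> c \<otimes> x) \<otimes> y \<in> Q" using q' by simp
  moreover have "u \<ominus> c \<otimes> x \<notin> P"
  proof
    assume "u \<ominus> c \<otimes> x \<in> P"
    then have "(u \<ominus> c \<otimes> x) \<oplus> c \<otimes> x \<in> P" using c x by (simp add: P.a_closed P.I_l_closed)
    moreover have "(u \<ominus> c \<otimes> x) \<oplus> c \<otimes> x = u" using u c xR by algebra
    ultimately show False using u by simp
  qed
  ultimately show ?thesis using u c xR by blast
qed

text \<open>
  The step of the descent along the chain. Cancelling \<open>x^n\<close> costs only a passage from \<open>I\<close> to its
  saturation by \<open>x\<close>, and the spare factor \<open>x^n\<close> on the right-hand side makes the remaining error
  term arbitrarily small \<open>x\<close>-adically, so that it disappears by Krull's theorem at the larger prime.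
  At the smaller prime, \<open>x\<close> is invertible and the saturation is no loss.
\<close>

lemma (in cring) pass_to_smaller_prime:
  assumes noeth: "noetherian_ring R" and "ideal I R"
    and "primeideal P R" and "primeideal P' R" and sub: "P \<subseteq> P'"
    and x: "x \<in> P'" "x \<notin> P" and y: "y \<in> carrier R"
    and rel: "\<And>n::nat. \<exists>u \<in> carrier R - P'. u \<otimes> (y \<otimes> x [^] n) \<in> I <+>\<^bsub>R\<^esub> PIdl (x [^] n \<otimes> x [^] n)"
  shows "\<exists>u \<in> carrier R - P. u \<otimes> y \<in> I"
proof -
  interpret I: ideal I R by fact
  interpret P: primeideal P R by fact
  interpret P': primeideal P' R by fact
  have xR: "x \<in> carrier R" using x(1) by (rule P'.Icarr)
  define Q where "Q = {r \<in> carrier R. \<exists>n::nat. x [^] n \<otimes> r \<in> I}"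
  have Q: "ideal Q R" unfolding Q_def using I.ideal_axioms xR by (rule saturation_is_ideal)
  have "\<exists>u \<in> carrier R - P'. u \<otimes> y \<in> Q <+>\<^bsub>R\<^esub> PIdl (x [^] n)" for n :: nat
  proof -
    obtain u where u: "u \<in> carrier R" "u \<notin> P'"
      and mem: "u \<otimes> (y \<otimes> x [^] n) \<in> I <+>\<^bsub>R\<^esub> PIdl (x [^] n \<otimes> x [^] n)"
      using rel[of n] by blast
    obtain i b where i: "i \<in> I" and b: "b \<in> carrier R"
      and eq: "u \<otimes> (y \<otimes> x [^] n) = i \<oplus> b \<otimes> (x [^] n \<otimes> x [^] n)"
      using mem by (elim mem_add_PIdl)
    define w where "w = x [^] n"
    have w: "w \<in> carrier R" unfolding w_def using xR by simp
    have iR: "i \<in> carrier R" using i by (rule I.Icarr)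
    have "w \<otimes> (u \<otimes> y \<ominus> b \<otimes> w) = u \<otimes> (y \<otimes> w) \<ominus> b \<otimes> (w \<otimes> w)"
      using u y b w by algebra
    also have "\<dots> = i" unfolding eq[folded w_def] using iR b w by algebra
    finally have "u \<otimes> y \<ominus> b \<otimes> w \<in> Q" unfolding Q_def w_def using i u y b xR by auto
    then have "(u \<otimes> y \<ominus> b \<otimes> w) \<oplus> b \<otimes> w \<in> Q <+>\<^bsub>R\<^esub> PIdl w" using b by (rule add_PIdlI)
    moreover have "(u \<otimes> y \<ominus> b \<otimes> w) \<oplus> b \<otimes> w = u \<otimes> y" using u y b w by algebra
    ultimately show ?thesis using u unfolding w_def by auto
  qed
  then obtain u where u: "u \<in> carrier R" "u \<notin> P'" and "u \<otimes> y \<in> Q"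
    using krull_intersection_at_prime[OF noeth Q P'.primeideal_axioms x(1) y] by blast
  then obtain n :: nat where n: "x [^] n \<otimes> (u \<otimes> y) \<in> I" unfolding Q_def by blast
  have pow: "x [^] m \<notin> P" for m :: nat
  proof (induction m)
    case 0
    show ?case using P.I_notcarr P.one_imp_carrier by auto
  next
    case (Suc m)
    then show ?case using P.I_prime[of "x [^] m" x] x(2) xR by auto
  qed
  have "x [^] n \<otimes> u \<notin> P" using P.I_prime[of "x [^] n" u] pow u sub xR by auto
  moreover have "(x [^] n \<otimes> u) \<otimes> y \<in> I" using n u y xR by (simp add: m_assoc)
  ultimately show ?thesis using u xR by blast
qed

section \<open>A monomial outside the ideal of squares\<close>

text \<open>
  The exponents are chosen one after the other along the chain: given \<open>M 0, \<dots>, M (r - 1)\<close> that work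
  at \<open>P r\<close>, some exponent of \<open>x r\<close> works at \<open>P (Suc r)\<close>, since otherwise
  \<open>pass_to_smaller_prime\<close> would contradict the choice already made. The multipliers \<open>u\<close>
  stand for the localization at \<open>P r\<close>, which changes with \<open>r\<close>.
\<close>

lemma (in cring) product_notin_ideal_of_squares:
  fixes P :: "nat \<Rightarrow> 'a set" and x :: "nat \<Rightarrow> 'a"
  assumes noeth: "noetherian_ring R"
    and prime: "\<And>i. i \<le> r \<Longrightarrow> primeideal (P i) R"
    and chain: "\<And>i. i < r \<Longrightarrow> P i \<subseteq> P (Suc i)"
    and x: "\<And>i. i < r \<Longrightarrow> x i \<in> P (Suc i) - P i"
  shows "\<exists>M :: nat \<Rightarrow> nat. \<forall>u \<in> carrier R - P r.
    u \<otimes> (\<Otimes>i\<in>{..<r}. x i [^] M i) \<notin> Idl ((\<lambda>i. x i [^] M i \<otimes> x i [^] M i) ` {..<r})"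
  using prime chain x
proof (induction r)
  case 0
  interpret P0: primeideal "P 0" R using 0 by simp
  have "Idl {} \<subseteq> {\<zero>}" by (rule genideal_minimal[OF zeroideal]) simp
  then show ?case using P0.zero_closed by auto
next
  case (Suc r)
  have xR: "x i \<in> carrier R" if "i < Suc r" for i
  proof -
    interpret primeideal "P (Suc i)" R using Suc.prems(1)[of "Suc i"] that by simp
    show ?thesis using Suc.prems(3)[OF that] Icarr by blast
  qed
  have "\<exists>M :: nat \<Rightarrow> nat. \<forall>u \<in> carrier R - P r.
      u \<otimes> (\<Otimes>i\<in>{..<r}. x i [^] M i) \<notin> Idl ((\<lambda>i. x i [^] M i \<otimes> x i [^] M i) ` {..<r})"
    by (rule Suc.IH) (use Suc.prems in auto)
  then obtain M :: "nat \<Rightarrow> nat" where M: "\<And>u. u \<in> carrier R - P r \<Longrightarrow>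
      u \<otimes> (\<Otimes>i\<in>{..<r}. x i [^] M i) \<notin> Idl ((\<lambda>i. x i [^] M i \<otimes> x i [^] M i) ` {..<r})"
    by blast
  let ?y = "\<Otimes>i\<in>{..<r}. x i [^] M i"
  let ?S = "(\<lambda>i. x i [^] M i \<otimes> x i [^] M i) ` {..<r}"
  have S: "?S \<subseteq> carrier R" using xR by auto
  have y: "?y \<in> carrier R" using xR by (intro finprod_closed) auto
  show ?case
  proof (rule ccontr)
    assume neg: "\<not> ?case"
    have "\<exists>u \<in> carrier R - P (Suc r).
        u \<otimes> (?y \<otimes> x r [^] n) \<in> Idl ?S <+>\<^bsub>R\<^esub> PIdl (x r [^] n \<otimes> x r [^] n)" for n :: nat
    proof -
      let ?M = "M(r := n)"
      obtain u where u: "u \<in> carrier R - P (Suc r)" and mem: "u \<otimes> (\<Otimes>i\<in>{..<Suc r}. x i [^] ?M i)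
          \<in> Idl ((\<lambda>i. x i [^] ?M i \<otimes> x i [^] ?M i) ` {..<Suc r})"
        using neg by blast
      have "(\<Otimes>i\<in>{..<r}. x i [^] ?M i) = ?y"
        using xR by (intro finprod_cong') auto
      then have "(\<Otimes>i\<in>{..<Suc r}. x i [^] ?M i) = ?y \<otimes> x r [^] n"
        using xR y unfolding lessThan_Suc
        by (subst finprod_insert) (auto simp: m_comm)
      moreover have "(\<lambda>i. x i [^] ?M i \<otimes> x i [^] ?M i) ` {..<Suc r}
          = insert (x r [^] n \<otimes> x r [^] n) ?S"
        by (auto simp: lessThan_Suc)
      ultimately show ?thesis
        using mem u genideal_insert_subset[OF S, of "x r [^] n \<otimes> x r [^] n"] xR by auto
    qed
    moreover have "primeideal (P r) R" "primeideal (P (Suc r)) R" "P r \<subseteq> P (Suc r)"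
      using Suc.prems(1,2) by auto
    moreover have "x r \<in> P (Suc r)" "x r \<notin> P r" using Suc.prems(3)[of r] by auto
    ultimately have "\<exists>u \<in> carrier R - P r. u \<otimes> ?y \<in> Idl ?S"
      by (intro pass_to_smaller_prime[OF noeth genideal_ideal[OF S], where P' = "P (Suc r)" and x = "x r"] y)
    then show False using M by blast
  qed
qed

section \<open>Products of elements with squares in an ideal\<close>

text \<open>
  The equation of integral dependence is \<open>t\<^sup>2 - a\<^sup>2 b\<^sup>2 = 0\<close>.
\<close>

lemma (in cring) product_integral_if_squares_in_ideal:
  assumes "ideal J R" and a: "a \<in> carrier R" "a \<otimes> a \<in> J" and b: "b \<in> carrier R" "b \<otimes> b \<in> J"
  shows "integral_over_ideal R J (a \<otimes> b)"
proof -
  interpret J: ideal J R by fact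
  define c :: "nat \<Rightarrow> 'a" where "c i = (if i = 1 then \<zero> else \<ominus> ((a \<otimes> a) \<otimes> (b \<otimes> b)))" for i
  have J1: "ideal_power R J (Suc 0) = carrier R \<cdot> J"
    by (simp add: ideal_power_Suc ideal_power_0)
  have J2: "ideal_power R J 2 = (carrier R \<cdot> J) \<cdot> J"
    by (simp add: numeral_2_eq_2 ideal_power_Suc ideal_power_0)
  have "\<one> \<otimes> \<zero> \<in> carrier R \<cdot> J" by (intro ideal_prod.prod) auto
  then have c1: "c 1 \<in> ideal_power R J 1" unfolding J1 One_nat_def by (simp add: c_def)
  have "(\<one> \<otimes> (a \<otimes> a)) \<otimes> (\<ominus> (b \<otimes> b)) \<in> (carrier R \<cdot> J) \<cdot> J"
    using a b by (intro ideal_prod.prod) auto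
  then have c2: "c 2 \<in> ideal_power R J 2" unfolding J2 using a b by (simp add: c_def r_minus)
  have set: "{1..2} = {1, 2::nat}" by auto
  have cR: "c i \<in> carrier R" for i using a b by (simp add: c_def)
  have "(\<Oplus>i\<in>{1..2}. c i \<otimes> (a \<otimes> b) [^] (2 - i)) = c 1 \<otimes> (a \<otimes> b) \<oplus> c 2 \<otimes> \<one>"
    unfolding set using cR a b by (subst finsum_insert) (auto simp: numeral_2_eq_2)
  also have "\<dots> = \<ominus> ((a \<otimes> a) \<otimes> (b \<otimes> b))" using a b by (simp add: c_def)
  finally have "(a \<otimes> b) [^] (2::nat) \<oplus> (\<Oplus>i\<in>{1..2}. c i \<otimes> (a \<otimes> b) [^] (2 - i))
      = (a \<otimes> b) \<otimes> (a \<otimes> b) \<ominus> (a \<otimes> a) \<otimes> (b \<otimes> b)"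
    using a b by (simp add: numeral_2_eq_2 minus_eq)
  also have "\<dots> = \<zero>" using a b by algebra
  finally have "(a \<otimes> b) [^] (2::nat) \<oplus> (\<Oplus>i\<in>{1..2}. c i \<otimes> (a \<otimes> b) [^] (2 - i)) = \<zero>" .
  moreover have "\<forall>i\<in>{1..2}. c i \<in> ideal_power R J i" unfolding set using c1 c2 by simp
  ultimately show ?thesis
    unfolding integral_over_ideal_def using a b
    by (intro conjI exI[of _ "2::nat"] exI[of _ c]) auto
qed

lemma (in cring) even_product_in_power_of_closure:
  fixes z :: "nat \<Rightarrow> 'a"
  assumes J: "ideal J R" and z: "\<And>i. i < 2 * j \<Longrightarrow> z i \<in> carrier R \<and> z i \<otimes> z i \<in> J"
  shows "(\<Otimes>i\<in>{..<2 * j}. z i) \<in> ideal_power R (ideal_integral_closure R J) j"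
  using z
proof (induction j)
  case 0
  show ?case by (simp add: ideal_power_0)
next
  case (Suc j)
  have zR: "z i \<in> carrier R" if "i < 2 * Suc j" for i using Suc.prems[OF that] by simp
  have pR: "(\<Otimes>i\<in>{..<2 * j}. z i) \<in> carrier R" using zR by (intro finprod_closed) auto
  have "z (2 * j) \<otimes> z (Suc (2 * j)) \<in> ideal_integral_closure R J"
    unfolding ideal_integral_closure_def
    using product_integral_if_squares_in_ideal[OF J] Suc.prems by simp
  with Suc have "(\<Otimes>i\<in>{..<2 * j}. z i) \<otimes> (z (2 * j) \<otimes> z (Suc (2 * j)))
      \<in> ideal_power R (ideal_integral_closure R J) (Suc j)"
    unfolding ideal_power_Suc by (intro ideal_prod.prod) auto
  also have "(\<Otimes>i\<in>{..<2 * j}. z i) \<otimes> (z (2 * j) \<otimes> z (Suc (2 * j))) = (\<Otimes>i\<in>{..<2 * Suc j}. z i)"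
  proof -
    have "{..<2 * Suc j} = insert (Suc (2 * j)) (insert (2 * j) {..<2 * j})" by auto
    moreover have "z \<in> {..<2 * j} \<rightarrow> carrier R" using zR by auto
    ultimately show ?thesis using zR pR by (simp add: m_ac)
  qed
  finally show ?case .
qed

section \<open>The bound on the dimension\<close>

lemma (in cring) prime_chain_length_bound:
  fixes P :: "nat \<Rightarrow> 'a set"
  assumes noeth: "noetherian_ring R" and bound: "integral_dim_bound R k"
    and prime: "\<And>i. i \<le> n \<Longrightarrow> primeideal (P i) R"
    and chain: "\<And>i. i < n \<Longrightarrow> P i \<subset> P (Suc i)"
  shows "n < 2 * Suc k"
proof (rule ccontr)
  assume "\<not> n < 2 * Suc k"
  \<comment> \<open>Pairing \<open>2k + 2\<close> factors reaches the exponent \<open>k + 1\<close>, the least one for which the bound gives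
    \<open>J\<close> instead of the whole ring.\<close>
  then have le: "2 * Suc k \<le> n" by simp
  have "\<exists>a. a \<in> P (Suc i) - P i" if "i < 2 * Suc k" for i
    using chain[of i] that le by auto
  then obtain x where x: "\<And>i. i < 2 * Suc k \<Longrightarrow> x i \<in> P (Suc i) - P i" by metis
  have xR: "x i \<in> carrier R" if "i < 2 * Suc k" for i
  proof -
    interpret primeideal "P (Suc i)" R using prime[of "Suc i"] that le by simp
    show ?thesis using x[OF that] Icarr by blast
  qed
  let ?r = "2 * Suc k"
  have "\<exists>M :: nat \<Rightarrow> nat. \<forall>u \<in> carrier R - P ?r.
    u \<otimes> (\<Otimes>i\<in>{..<?r}. x i [^] M i) \<notin> Idl ((\<lambda>i. x i [^] M i \<otimes> x i [^] M i) ` {..<?r})"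
  proof (rule product_notin_ideal_of_squares[OF noeth])
    show "primeideal (P i) R" if "i \<le> ?r" for i using prime that le by simp
    show "P i \<subseteq> P (Suc i)" if "i < ?r" for i using chain[of i] that le by auto
  qed (rule x)
  then obtain M :: "nat \<Rightarrow> nat" where M: "\<And>u. u \<in> carrier R - P ?r \<Longrightarrow>
      u \<otimes> (\<Otimes>i\<in>{..<?r}. x i [^] M i) \<notin> Idl ((\<lambda>i. x i [^] M i \<otimes> x i [^] M i) ` {..<?r})"
    by blast
  define z where "z i = x i [^] M i" for i
  define J where "J = Idl ((\<lambda>i. z i \<otimes> z i) ` {..<?r})"
  have zR: "z i \<in> carrier R" if "i < ?r" for i using xR[OF that] by (simp add: z_def)
  have S: "(\<lambda>i. z i \<otimes> z i) ` {..<?r} \<subseteq> carrier R" using zR by auto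
  have J: "ideal J R" unfolding J_def using S by (rule genideal_ideal)
  have zJ: "z i \<otimes> z i \<in> J" if "i < ?r" for i
    using genideal_self[OF S] that unfolding J_def by auto
  have "(\<Otimes>i\<in>{..<?r}. z i) \<in> ideal_power R (ideal_integral_closure R J) (Suc k)"
    using J by (rule even_product_in_power_of_closure) (use zR zJ in auto)
  also have "\<dots> \<subseteq> ideal_power R J (Suc k - k)"
    using bound J unfolding integral_dim_bound_def by (metis le_Suc_eq order_refl)
  also have "\<dots> = carrier R \<cdot> J" by (simp add: ideal_power_Suc ideal_power_0)
  also have "\<dots> \<subseteq> J" using ideal_prod_inter[OF oneideal J] by blast
  finally have "(\<Otimes>i\<in>{..<?r}. z i) \<in> J" .
  moreover have "(\<Otimes>i\<in>{..<?r}. z i) \<in> carrier R" using zR by (intro finprod_closed) auto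
  moreover interpret Pr: primeideal "P ?r" R using prime le by simp
  have "\<one> \<notin> P ?r" using Pr.I_notcarr Pr.one_imp_carrier by auto
  ultimately show False using M[of \<one>] unfolding z_def[symmetric] J_def[symmetric] by simp
qed

theorem corollary2p11:
  fixes R :: "('a, 'b) ring_scheme"
  assumes "cring R"
    and "noetherian_ring R"
    and "integral_dim R < \<infinity>"
  shows "krull_dim R < \<infinity>"
proof -
  interpret cring R by fact
  obtain k where k: "integral_dim_bound R k"
    using assms(3) unfolding integral_dim_def by (auto split: if_splits)
  have "krull_dim R \<le> enat (2 * k + 1)"
    unfolding krull_dim_def
  proof (rule Sup_least)
    fix e assume "e \<in> {enat n | n. \<exists>P :: nat \<Rightarrow> 'a set.
      (\<forall>i\<le>n. primeideal (P i) R) \<and> (\<forall>i<n. P i \<subset> P (Suc i))}"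
    then obtain n P where e: "e = enat n" and "\<And>i. i \<le> n \<Longrightarrow> primeideal (P i) R"
      "\<And>i. i < n \<Longrightarrow> P i \<subset> P (Suc i)" by blast
    then have "n < 2 * Suc k" by (intro prime_chain_length_bound[OF assms(2) k])
    then show "e \<le> enat (2 * k + 1)" using e by simp
  qed
  then show ?thesis using enat_ord_simps(4) le_less_trans by blast
qed

end
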